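(* Let $\Omega\subset\mathbb{R}^2$ be a bounded domain with boundary of class $C^2$. Let $p,q\in(1,\infty)$ and $\mu\in(\frac1p,1]$ be such that $\frac12+\frac1p+\frac1q<\mu\le1$. Then, for fixed $v_0\in V_\mu$, the principal part of Hibler's operator $\mathcal{A}^H(v_0)$ is strongly elliptic and moreover parameter-elliptic of angle $\phi_{\mathcal{A}^H(v_0)}=0$.
   Context: **Spaces.** $X_0=L_q(\Omega;\mathbb{R}^2)\times L_q(\Omega)\times L_q(\Omega)$ and $$X_1=\{u\in H^2_q(\Omega;\mathbb{R}^2):u=0\text{ on }\partial\Omega\}\times\{h\in H^2_q(\Omega):\partial_\nu h=0\text{ on }\partial\Omega\}\times\{a\in H^2_q(\Omega):\partial_\nu a=0\text{ on }\partial\Omega\}.$$ $X_{\gamma,\mu}=(X_0,X_1)_{\mu-1/p,p}$ (real interpolation), which embeds into $C^1(\overline\Omega)^4$. $V_\mu$ is an open subset of $X_{\gamma,\mu}$ such that all $(u,h,a)\in V_\mu$ satisfy $h\ge\kappa$ for some $\kappa>0$ and $a\in[0,1]$. **Hibler's operator.** $\delta,e,p^*,c>0$ are fixed constants, $\varepsilon(u)=\frac12(\nabla u+\nabla u^T)$, $P(h,a)=p^*h\exp(-c(1-a))$. The linear map $\mathbb{S}:\mathbb{R}^{2\times2}\to\mathbb{R}^{2\times2}$ is $$\mathbb{S}\varepsilon=\begin{pmatrix}(1+\frac1{e^2})\varepsilon_{11}+(1-\frac1{e^2})\varepsilon_{22}&\frac1{e^2}(\varepsilon_{12}+\varepsilon_{21})\\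 \frac1{e^2}(\varepsilon_{12}+\varepsilon_{21})&(1-\frac1{e^2})\varepsilon_{11}+(1+\frac1{e^2})\varepsilon_{22}\end{pmatrix},$$ with coefficients $\mathbb{S}_{ij}^{kl}$ given by $(\mathbb{S}\varepsilon)_{ik}=\sum_{j,l=1}^2\mathbb{S}_{ij}^{kl}\varepsilon_{jl}$. Put $\triangle^2(\varepsilon)=\sum_{i,j,k,l}\varepsilon_{ik}\mathbb{S}_{ij}^{kl}\varepsilon_{jl}$, $\triangle_\delta(\varepsilon)=\sqrt{\delta+\triangle^2(\varepsilon)}$. For $v_0=(u_0,h_0,a_0)\in V_\mu$ set, with $\varepsilon=\varepsilon(u_0)$, $$a_{ij}^{kl}=a_{ij}^{kl}(\nabla u_0,P(h_0,a_0))=\frac{P(h_0,a_0)}{2\triangle_\delta(\varepsilon)}\Big(\mathbb{S}_{ij}^{kl}-\frac{1}{\triangle_\delta^2(\varepsilon)}(\mathbb{S}\varepsilon)_{ik}(\mathbb{S}\varepsilon)_{jl}\Big),$$ functions in $C(\overline\Omega)$. With $D_m=-\mathrm{i}\partial_m$, $$[\mathcal{A}^H(v_0)u]_i=\sum_{j,k,l=1}^2a_{ij}^{kl}D_kD_lu_j-\frac{1}{2\triangle_\delta(\varepsilon(u_0))}\sum_{j=1}^2\big(\partial_jP(h_0,a_0)\big)(\mathbb{S}\varepsilon(u))_{ij},\quad i=1,2.$$ The symbol of its principal part is the $2\times2$ matrix $(\mathcal{A}^H_\#(x,\xi))_{ij}=\sum_{k,l=1}^2a_{ij}^{kl}(x)\xi_k\xi_l$,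 $x\in\overline\Omega$, $\xi\in\mathbb{R}^2$. **Ellipticity.** The operator is *strongly elliptic* if there is $c_0>0$ with $\operatorname{Re}(\mathcal{A}^H_\#(x,\xi)w\,|\,w)\ge c_0\|w\|^2$ for all $x\in\overline\Omega$, $\xi\in\mathbb{R}^2$ with $|\xi|=1$ and $w\in\mathbb{C}^2$. With $\Sigma_\theta=\{z\in\mathbb{C}\setminus\{0\}:|\arg z|<\theta\}$, it is *parameter-elliptic of angle* $\phi\in(0,\pi]$ if the spectrum of $\mathcal{A}^H_\#(x,\xi)$ is contained in $\Sigma_\phi$ for all $x\in\overline\Omega$ and all $\xi\in\mathbb{R}^2$ with $|\xi|=1$; the *angle of ellipticity* $\phi_{\mathcal{A}^H(v_0)}$ is the infimum of all such $\phi$, and "parameter-elliptic of angle $\phi_{\mathcal{A}^H(v_0)}=0$" means that this infimum equals $0$. *)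

theory Defs
  imports "HOL-Analysis.Analysis" "HOL-Library.Function_Algebras"
begin

type_synonym pt = "real^2"

section \<open>Classical derivatives and boundary regularity\<close>

definition pd :: "2 \<Rightarrow> (pt \<Rightarrow> 'b::real_normed_vector) \<Rightarrow> pt \<Rightarrow> 'b" where
  "pd m f x = frechet_derivative f (at x) (axis m 1)"

text \<open>\<open>Ck_on k S f\<close> is meant for open \<open>S\<close>.\<close>

primrec Ck_on :: "nat \<Rightarrow> pt set \<Rightarrow> (pt \<Rightarrow> real) \<Rightarrow> bool" where
  "Ck_on 0 S f \<longleftrightarrow> continuous_on S f"
| "Ck_on (Suc k) S f \<longleftrightarrow> (\<forall>x\<in>S. f differentiable (at x)) \<and> (\<forall>m. Ck_on k S (pd m f))"

definition grad :: "(pt \<Rightarrow> real) \<Rightarrow> pt \<Rightarrow> real^2" where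
  "grad f x = (\<chi> m. pd m f x)"

definition C2_defining_function :: "pt set \<Rightarrow> pt \<Rightarrow> real \<Rightarrow> (pt \<Rightarrow> real) \<Rightarrow> bool" where
  "C2_defining_function \<Omega> x r \<rho> \<longleftrightarrow>
     r > 0 \<and> Ck_on 2 (ball x r) \<rho> \<and> (\<forall>y\<in>ball x r. grad \<rho> y \<noteq> 0) \<and>
     \<Omega> \<inter> ball x r = {y \<in> ball x r. \<rho> y < 0}"

definition C2_boundary :: "pt set \<Rightarrow> bool" where
  "C2_boundary \<Omega> \<longleftrightarrow> (\<forall>x\<in>frontier \<Omega>. \<exists>r \<rho>. C2_defining_function \<Omega> x r \<rho>)"

definition outer_normal :: "pt set \<Rightarrow> pt \<Rightarrow> real^2" where
  "outer_normal \<Omega> x =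
     (THE \<nu>. \<exists>r \<rho>. C2_defining_function \<Omega> x r \<rho> \<and> \<nu> = (1 / norm (grad \<rho> x)) *\<^sub>R grad \<rho> x)"

text \<open>\<open>C1_closure \<Omega>\<close> is \<open>C\<^sup>1\<close> of the closure of an open set \<open>\<Omega>\<close>: the first-order derivatives,
  which exist in \<open>\<Omega>\<close>, extend continuously to the closure. The extension is \<open>cl_pd\<close>; inside \<open>\<Omega>\<close>
  it agrees with \<open>pd\<close> for functions in \<open>C1_closure \<Omega>\<close>.\<close>

definition C1_closure :: "pt set \<Rightarrow> (pt \<Rightarrow> 'b::real_normed_vector) set" where
  "C1_closure \<Omega> = {f. continuous_on (closure \<Omega>) f \<and> (\<forall>x\<in>\<Omega>. f differentiable (at x)) \<and>
     (\<forall>m. \<exists>g. continuous_on (closure \<Omega>) g \<and> (\<forall>x\<in>\<Omega>. g x = pd m f x))}"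

definition cl_pd :: "pt set \<Rightarrow> 2 \<Rightarrow> (pt \<Rightarrow> 'b::real_normed_vector) \<Rightarrow> pt \<Rightarrow> 'b" where
  "cl_pd \<Omega> m f x = Lim (at x within \<Omega>) (pd m f)"

section \<open>Lebesgue and Sobolev spaces\<close>

text \<open>Elements of the spaces are functions on the whole plane of which only the restriction to
  \<open>\<Omega>\<close>, up to null sets, matters: all sets below are closed under changes outside \<open>\<Omega>\<close> and on null
  sets, and the norms, seminorms on functions, are unaffected by them.\<close>

definition Lq :: "pt set \<Rightarrow> real \<Rightarrow> (pt \<Rightarrow> 'b::euclidean_space) set" where
  "Lq \<Omega> q = {f. f \<in> borel_measurable (lebesgue_on \<Omega>) \<and>
                 integrable (lebesgue_on \<Omega>) (\<lambda>x. norm (f x) powr q)}"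

definition Lq_norm :: "pt set \<Rightarrow> real \<Rightarrow> (pt \<Rightarrow> 'b::euclidean_space) \<Rightarrow> real" where
  "Lq_norm \<Omega> q f = (LINT x|lebesgue_on \<Omega>. norm (f x) powr q) powr (1 / q)"

definition loc_integrable :: "pt set \<Rightarrow> (pt \<Rightarrow> 'b::euclidean_space) \<Rightarrow> bool" where
  "loc_integrable \<Omega> f \<longleftrightarrow> (\<forall>K. compact K \<and> K \<subseteq> \<Omega> \<longrightarrow> set_integrable lebesgue K f)"

definition test_function :: "pt set \<Rightarrow> (pt \<Rightarrow> real) \<Rightarrow> bool" where
  "test_function \<Omega> \<phi> \<longleftrightarrow> (\<forall>k. Ck_on k UNIV \<phi>) \<and>
     compact (closure {x. \<phi> x \<noteq> 0}) \<and> closure {x. \<phi> x \<noteq> 0} \<subseteq> \<Omega>"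

definition has_weak_pd ::
  "pt set \<Rightarrow> 2 \<Rightarrow> (pt \<Rightarrow> 'b::euclidean_space) \<Rightarrow> (pt \<Rightarrow> 'b) \<Rightarrow> bool" where
  "has_weak_pd \<Omega> m f g \<longleftrightarrow> loc_integrable \<Omega> f \<and> loc_integrable \<Omega> g \<and>
     (\<forall>\<phi>. test_function \<Omega> \<phi> \<longrightarrow>
        (LINT x|lebesgue_on \<Omega>. pd m \<phi> x *\<^sub>R f x) = - (LINT x|lebesgue_on \<Omega>. \<phi> x *\<^sub>R g x))"

text \<open>Determined up to null sets in \<open>\<Omega>\<close> whenever a weak derivative exists.\<close>

definition weak_pd :: "pt set \<Rightarrow> 2 \<Rightarrow> (pt \<Rightarrow> 'b::euclidean_space) \<Rightarrow> pt \<Rightarrow> 'b" where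
  "weak_pd \<Omega> m f = (SOME g. has_weak_pd \<Omega> m f g)"

definition H2q :: "pt set \<Rightarrow> real \<Rightarrow> (pt \<Rightarrow> 'b::euclidean_space) set" where
  "H2q \<Omega> q = {f \<in> Lq \<Omega> q. \<forall>m. \<exists>g \<in> Lq \<Omega> q. has_weak_pd \<Omega> m f g \<and>
                               (\<forall>l. \<exists>h \<in> Lq \<Omega> q. has_weak_pd \<Omega> l g h)}"

definition H2q_norm :: "pt set \<Rightarrow> real \<Rightarrow> (pt \<Rightarrow> 'b::euclidean_space) \<Rightarrow> real" where
  "H2q_norm \<Omega> q f = Lq_norm \<Omega> q f + (\<Sum>m\<in>UNIV. Lq_norm \<Omega> q (weak_pd \<Omega> m f)) +
     (\<Sum>m\<in>UNIV. \<Sum>l\<in>UNIV. Lq_norm \<Omega> q (weak_pd \<Omega> l (weak_pd \<Omega> m f)))"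

text \<open>Boundary conditions are imposed on the \<open>C\<^sup>1\<close> representative. This is the trace condition when
  \<open>q > 2\<close>, where \<open>H\<^sup>2\<^sub>q\<close> embeds into \<open>C\<^sup>1\<close> of the closure; \<open>1/2 + 1/p + 1/q < \<mu> \<le> 1\<close> forces \<open>q > 2\<close>.\<close>

definition dirichlet_zero :: "pt set \<Rightarrow> (pt \<Rightarrow> 'b::euclidean_space) \<Rightarrow> bool" where
  "dirichlet_zero \<Omega> u \<longleftrightarrow> (\<exists>w \<in> C1_closure \<Omega>. (AE x in lebesgue_on \<Omega>. w x = u x) \<and>
     (\<forall>x\<in>frontier \<Omega>. w x = 0))"

definition neumann_zero :: "pt set \<Rightarrow> (pt \<Rightarrow> real) \<Rightarrow> bool" where
  "neumann_zero \<Omega> h \<longleftrightarrow> (\<exists>w \<in> C1_closure \<Omega>. (AE x in lebesgue_on \<Omega>. w x = h x) \<and>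
     (\<forall>x\<in>frontier \<Omega>. (\<Sum>m\<in>UNIV. outer_normal \<Omega> x $ m * cl_pd \<Omega> m w x) = 0))"

type_synonym state = "(pt \<Rightarrow> real^2) \<times> (pt \<Rightarrow> real) \<times> (pt \<Rightarrow> real)"

definition X0 :: "pt set \<Rightarrow> real \<Rightarrow> state set" where
  "X0 \<Omega> q = Lq \<Omega> q \<times> Lq \<Omega> q \<times> Lq \<Omega> q"

definition X0_norm :: "pt set \<Rightarrow> real \<Rightarrow> state \<Rightarrow> real" where
  "X0_norm \<Omega> q = (\<lambda>(u, h, a). Lq_norm \<Omega> q u + Lq_norm \<Omega> q h + Lq_norm \<Omega> q a)"

definition X1 :: "pt set \<Rightarrow> real \<Rightarrow> state set" where
  "X1 \<Omega> q = {u \<in> H2q \<Omega> q. dirichlet_zero \<Omega> u} \<times>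
            {h \<in> H2q \<Omega> q. neumann_zero \<Omega> h} \<times> {a \<in> H2q \<Omega> q. neumann_zero \<Omega> a}"

definition X1_norm :: "pt set \<Rightarrow> real \<Rightarrow> state \<Rightarrow> real" where
  "X1_norm \<Omega> q = (\<lambda>(u, h, a). H2q_norm \<Omega> q u + H2q_norm \<Omega> q h + H2q_norm \<Omega> q a)"

section \<open>Real interpolation by the K-method\<close>

definition K_functional ::
  "'a::plus set \<Rightarrow> ('a \<Rightarrow> real) \<Rightarrow> 'a set \<Rightarrow> ('a \<Rightarrow> real) \<Rightarrow> real \<Rightarrow> 'a \<Rightarrow> real" where
  "K_functional Y0 n0 Y1 n1 t v =
     Inf {n0 v0 + t * n1 v1 | v0 v1. v0 \<in> Y0 \<and> v1 \<in> Y1 \<and> v = v0 + v1}"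

definition interp_integral ::
  "'a::plus set \<Rightarrow> ('a \<Rightarrow> real) \<Rightarrow> 'a set \<Rightarrow> ('a \<Rightarrow> real) \<Rightarrow> real \<Rightarrow> real \<Rightarrow> 'a \<Rightarrow> ennreal" where
  "interp_integral Y0 n0 Y1 n1 \<theta> p v =
     (\<integral>\<^sup>+ t\<in>{0<..}. ennreal ((t powr (-\<theta>) * K_functional Y0 n0 Y1 n1 t v) powr p / t) \<partial>lborel)"

definition interp_space ::
  "'a::plus set \<Rightarrow> ('a \<Rightarrow> real) \<Rightarrow> 'a set \<Rightarrow> ('a \<Rightarrow> real) \<Rightarrow> real \<Rightarrow> real \<Rightarrow> 'a set" where
  "interp_space Y0 n0 Y1 n1 \<theta> p =
     {v. (\<exists>v0\<in>Y0. \<exists>v1\<in>Y1. v = v0 + v1) \<and> interp_integral Y0 n0 Y1 n1 \<theta> p v < \<infinity>}"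

definition interp_norm ::
  "'a::plus set \<Rightarrow> ('a \<Rightarrow> real) \<Rightarrow> 'a set \<Rightarrow> ('a \<Rightarrow> real) \<Rightarrow> real \<Rightarrow> real \<Rightarrow> 'a \<Rightarrow> real" where
  "interp_norm Y0 n0 Y1 n1 \<theta> p v = enn2real (interp_integral Y0 n0 Y1 n1 \<theta> p v) powr (1 / p)"

definition Xgm :: "pt set \<Rightarrow> real \<Rightarrow> real \<Rightarrow> real \<Rightarrow> state set" where
  "Xgm \<Omega> p q \<mu> =
     interp_space (X0 \<Omega> q) (X0_norm \<Omega> q) (X1 \<Omega> q) (X1_norm \<Omega> q) (\<mu> - 1 / p) p"

definition Xgm_norm :: "pt set \<Rightarrow> real \<Rightarrow> real \<Rightarrow> real \<Rightarrow> state \<Rightarrow> real" where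
  "Xgm_norm \<Omega> p q \<mu> =
     interp_norm (X0 \<Omega> q) (X0_norm \<Omega> q) (X1 \<Omega> q) (X1_norm \<Omega> q) (\<mu> - 1 / p) p"

definition open_in_Xgm :: "pt set \<Rightarrow> real \<Rightarrow> real \<Rightarrow> real \<Rightarrow> state set \<Rightarrow> bool" where
  "open_in_Xgm \<Omega> p q \<mu> V \<longleftrightarrow> V \<subseteq> Xgm \<Omega> p q \<mu> \<and>
     (\<forall>v\<in>V. \<exists>r>0. \<forall>w\<in>Xgm \<Omega> p q \<mu>. Xgm_norm \<Omega> p q \<mu> (w - v) < r \<longrightarrow> w \<in> V)"

section \<open>Hibler's operator\<close>

text \<open>\<open>hibler_S\<close> acts on real matrices and, by the same formula, on complex ones.\<close>

definition hibler_S :: "real \<Rightarrow> 'a::real_vector^2^2 \<Rightarrow> 'a^2^2" where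
  "hibler_S e E = vector
     [vector [(1 + 1/e^2) *\<^sub>R E$1$1 + (1 - 1/e^2) *\<^sub>R E$2$2, (1/e^2) *\<^sub>R (E$1$2 + E$2$1)],
      vector [(1/e^2) *\<^sub>R (E$1$2 + E$2$1), (1 - 1/e^2) *\<^sub>R E$1$1 + (1 + 1/e^2) *\<^sub>R E$2$2]]"

text \<open>\<open>S_coeff e i j k l\<close> is the coefficient with lower indices \<open>i j\<close> and upper indices \<open>k l\<close>,
  namely entry \<open>(i, k)\<close> of the image of the matrix unit with a one in position \<open>(j, l)\<close>.\<close>

definition S_coeff :: "real \<Rightarrow> 2 \<Rightarrow> 2 \<Rightarrow> 2 \<Rightarrow> 2 \<Rightarrow> real" where
  "S_coeff e i j k l = hibler_S e (\<chi> r s. if r = j \<and> s = l then 1 else 0) $ i $ k"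

lemma hibler_S_eq_S_coeff:
  fixes E :: "real^2^2"
  shows "hibler_S e E $ i $ k = (\<Sum>j\<in>UNIV. \<Sum>l\<in>UNIV. S_coeff e i j k l * E $ j $ l)"
  using exhaust_2[of i] exhaust_2[of k]
  by (auto simp: S_coeff_def hibler_S_def sum_2 algebra_simps)

definition tri2 :: "real \<Rightarrow> real^2^2 \<Rightarrow> real" where
  "tri2 e E = (\<Sum>i\<in>UNIV. \<Sum>j\<in>UNIV. \<Sum>k\<in>UNIV. \<Sum>l\<in>UNIV. E$i$k * S_coeff e i j k l * E$j$l)"

definition tri_delta :: "real \<Rightarrow> real \<Rightarrow> real^2^2 \<Rightarrow> real" where
  "tri_delta \<delta> e E = sqrt (\<delta> + tri2 e E)"

definition sym_part :: "'a::real_vector^2^2 \<Rightarrow> 'a^2^2" where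
  "sym_part G = (\<chi> i j. (1/2) *\<^sub>R (G$i$j + G$j$i))"

definition ice_P :: "real \<Rightarrow> real \<Rightarrow> real \<Rightarrow> real \<Rightarrow> real" where
  "ice_P ps c h a = ps * h * exp (- c * (1 - a))"

text \<open>The coefficient with lower indices \<open>i j\<close> and upper indices \<open>k l\<close>, as a function of the values
  \<open>G\<close> of the velocity gradient and \<open>P\<close> of the pressure.\<close>

definition hibler_a :: "real \<Rightarrow> real \<Rightarrow> real^2^2 \<Rightarrow> real \<Rightarrow> 2 \<Rightarrow> 2 \<Rightarrow> 2 \<Rightarrow> 2 \<Rightarrow> real" where
  "hibler_a \<delta> e G P i j k l =
     (let E = sym_part G in
        P / (2 * tri_delta \<delta> e E) *
          (S_coeff e i j k l - 1 / (tri_delta \<delta> e E)^2 * hibler_S e E $ i $ k * hibler_S e E $ j $ l))"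

definition cl_jacobian :: "pt set \<Rightarrow> (pt \<Rightarrow> real^2) \<Rightarrow> pt \<Rightarrow> real^2^2" where
  "cl_jacobian \<Omega> u x = (\<chi> i j. cl_pd \<Omega> j u x $ i)"

definition hibler_coeff ::
  "real \<Rightarrow> real \<Rightarrow> real \<Rightarrow> real \<Rightarrow> pt set \<Rightarrow> state \<Rightarrow> pt \<Rightarrow> 2 \<Rightarrow> 2 \<Rightarrow> 2 \<Rightarrow> 2 \<Rightarrow> real" where
  "hibler_coeff \<delta> e ps c \<Omega> = (\<lambda>(u0, h0, a0) x.
     hibler_a \<delta> e (cl_jacobian \<Omega> u0 x) (ice_P ps c (h0 x) (a0 x)))"

definition Dw :: "pt set \<Rightarrow> 2 \<Rightarrow> (pt \<Rightarrow> complex) \<Rightarrow> pt \<Rightarrow> complex" where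
  "Dw \<Omega> m f x = - \<i> * weak_pd \<Omega> m f x"

text \<open>A second-order operator on \<open>\<complex>\<^sup>2\<close>-valued functions is a pair: its top-order coefficients
  \<open>b x i j k l\<close> (lower indices \<open>i j\<close>, upper indices \<open>k l\<close>) and its part of order at most one.\<close>

type_synonym op2 = "(pt \<Rightarrow> 2 \<Rightarrow> 2 \<Rightarrow> 2 \<Rightarrow> 2 \<Rightarrow> real) \<times> ((pt \<Rightarrow> complex^2) \<Rightarrow> pt \<Rightarrow> complex^2)"

definition principal_part :: "pt set \<Rightarrow> op2 \<Rightarrow> (pt \<Rightarrow> complex^2) \<Rightarrow> pt \<Rightarrow> complex^2" where
  "principal_part \<Omega> A u x = (\<chi> i. \<Sum>j\<in>UNIV. \<Sum>k\<in>UNIV. \<Sum>l\<in>UNIV.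
     of_real (fst A x i j k l) * Dw \<Omega> k (Dw \<Omega> l (\<lambda>y. u y $ j)) x)"

definition apply_op2 :: "pt set \<Rightarrow> op2 \<Rightarrow> (pt \<Rightarrow> complex^2) \<Rightarrow> pt \<Rightarrow> complex^2" where
  "apply_op2 \<Omega> A u x = principal_part \<Omega> A u x + snd A u x"

definition principal_symbol :: "op2 \<Rightarrow> pt \<Rightarrow> real^2 \<Rightarrow> complex^2^2" where
  "principal_symbol A x \<xi> =
     (\<chi> i j. \<Sum>k\<in>UNIV. \<Sum>l\<in>UNIV. of_real (fst A x i j k l * \<xi>$k * \<xi>$l))"

definition hibler_lower_order ::
  "real \<Rightarrow> real \<Rightarrow> real \<Rightarrow> real \<Rightarrow> pt set \<Rightarrow> state \<Rightarrow> (pt \<Rightarrow> complex^2) \<Rightarrow> pt \<Rightarrow> complex^2" where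
  "hibler_lower_order \<delta> e ps c \<Omega> = (\<lambda>(u0, h0, a0) u x. \<chi> i.
     - of_real (1 / (2 * tri_delta \<delta> e (sym_part (cl_jacobian \<Omega> u0 x)))) *
       (\<Sum>j\<in>UNIV. of_real (cl_pd \<Omega> j (\<lambda>y. ice_P ps c (h0 y) (a0 y)) x) *
          hibler_S e (sym_part (\<chi> r s. weak_pd \<Omega> s (\<lambda>y. u y $ r) x)) $ i $ j))"

text \<open>The operator linearized at \<open>v0\<close>, on the complexification of the velocity space;
  \<open>apply_op2 \<Omega> (hibler_op \<delta> e ps c \<Omega> v0) u\<close> is its value at \<open>u\<close>. The component functions of
  \<open>v0\<close> have to be the representatives in \<open>C1_closure \<Omega>\<close>.\<close>

definition hibler_op :: "real \<Rightarrow> real \<Rightarrow> real \<Rightarrow> real \<Rightarrow> pt set \<Rightarrow> state \<Rightarrow> op2" where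
  "hibler_op \<delta> e ps c \<Omega> v0 = (hibler_coeff \<delta> e ps c \<Omega> v0, hibler_lower_order \<delta> e ps c \<Omega> v0)"

section \<open>Ellipticity\<close>

definition cinner2 :: "complex^2 \<Rightarrow> complex^2 \<Rightarrow> complex" where
  "cinner2 z w = (\<Sum>i\<in>UNIV. z$i * cnj (w$i))"

definition spectrum :: "complex^2^2 \<Rightarrow> complex set" where
  "spectrum M = {z. \<not> invertible (M - mat z)}"

definition sector :: "real \<Rightarrow> complex set" where
  "sector \<theta> = {z. z \<noteq> 0 \<and> \<bar>Arg z\<bar> < \<theta>}"

definition strongly_elliptic :: "pt set \<Rightarrow> (pt \<Rightarrow> real^2 \<Rightarrow> complex^2^2) \<Rightarrow> bool" where
  "strongly_elliptic K A \<longleftrightarrow> (\<exists>c0>0. \<forall>x\<in>K. \<forall>\<xi>. norm \<xi> = 1 \<longrightarrow>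
     (\<forall>w. Re (cinner2 (A x \<xi> *v w) w) \<ge> c0 * (norm w)^2))"

definition parameter_elliptic :: "pt set \<Rightarrow> (pt \<Rightarrow> real^2 \<Rightarrow> complex^2^2) \<Rightarrow> real \<Rightarrow> bool" where
  "parameter_elliptic K A \<phi> \<longleftrightarrow> 0 < \<phi> \<and> \<phi> \<le> pi \<and>
     (\<forall>x\<in>K. \<forall>\<xi>. norm \<xi> = 1 \<longrightarrow> spectrum (A x \<xi>) \<subseteq> sector \<phi>)"

text \<open>Meaningful only if the operator is parameter-elliptic of some angle.\<close>

definition ellipticity_angle :: "pt set \<Rightarrow> (pt \<Rightarrow> real^2 \<Rightarrow> complex^2^2) \<Rightarrow> real" where
  "ellipticity_angle K A = Inf {\<phi>. parameter_elliptic K A \<phi>}"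

end

theory Submission
  imports Defs
begin

text \<open>For real \<open>\<eta>\<close> the quadratic form of the symbol is a positive multiple of
  \<open>\<triangle>\<^sup>2(\<eta> \<otimes> \<xi>) - (\<S>\<epsilon> : \<eta> \<otimes> \<xi>)\<^sup>2 / \<triangle>\<^sub>\<delta>\<^sup>2(\<epsilon>)\<close>, which by the Cauchy-Schwarz inequality for the
  form \<open>\<triangle>\<^sup>2\<close> is at least \<open>\<delta> \<triangle>\<^sup>2(\<eta> \<otimes> \<xi>) / \<triangle>\<^sub>\<delta>\<^sup>2(\<epsilon>)\<close>, and \<open>\<triangle>\<^sup>2(\<eta> \<otimes> \<xi>) \<ge> \<bar>\<eta>\<bar>\<^sup>2 \<bar>\<xi>\<bar>\<^sup>2 / e\<^sup>2\<close>.
  The gradient of the velocity is bounded on the compact closure of \<open>\<Omega>\<close> and the pressure is bounded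
  below, so the bound is uniform. As the symbol is real and symmetric, its spectrum lies in
  \<open>(0, \<infinity>)\<close>.\<close>

section \<open>The quadratic form \<open>tri2\<close> and the coefficients
  \<open>hibler_a\<close>\<close>

lemma tri2_eq:
  "tri2 e E = (E$1$1 + E$2$2)^2 + 1/e^2 * ((E$1$1 - E$2$2)^2 + (E$1$2 + E$2$1)^2)"
  by (simp add: tri2_def S_coeff_def hibler_S_def sum_2 power2_eq_square algebra_simps)

lemma tri2_nonneg: "0 \<le> tri2 e E"
  by (simp add: tri2_eq)

lemma hibler_S_pairing_eq:
  fixes E F :: "real^2^2"
  shows "(\<Sum>i\<in>UNIV. \<Sum>k\<in>UNIV. hibler_S e E $ i $ k * F $ i $ k) =
    (E$1$1 + E$2$2) * (F$1$1 + F$2$2) +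
    1/e^2 * ((E$1$1 - E$2$2) * (F$1$1 - F$2$2) + (E$1$2 + E$2$1) * (F$1$2 + F$2$1))"
  by (simp add: hibler_S_def sum_2 algebra_simps)

text \<open>The pairing is the symmetric bilinear form polar to \<open>tri2\<close>; trace,
  difference of the diagonal entries and sum of the off-diagonal entries diagonalise both.\<close>

lemma hibler_S_Cauchy_Schwarz:
  fixes E F :: "real^2^2"
  shows "(\<Sum>i\<in>UNIV. \<Sum>k\<in>UNIV. hibler_S e E $ i $ k * F $ i $ k)^2 \<le> tri2 e E * tri2 e F"
proof -
  have CS: "(t * t' + c * (d * d' + s * s'))^2
      \<le> (t^2 + c * (d^2 + s^2)) * (t'^2 + c * (d'^2 + s'^2))"
    if "0 \<le> c" for t t' d d' s s' c :: real
  proof -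
    \<comment> \<open>Lagrange's identity with weights 1, \<open>c\<close>,
      \<open>c\<close>.\<close>
    have "(t^2 + c * (d^2 + s^2)) * (t'^2 + c * (d'^2 + s'^2)) - (t * t' + c * (d * d' + s * s'))^2
        = c * (t * d' - d * t')^2 + c * (t * s' - s * t')^2 + c^2 * (d * s' - s * d')^2"
      by (simp add: power2_eq_square algebra_simps)
    moreover have "0 \<le> \<dots>" using that by simp
    ultimately show ?thesis by linarith
  qed
  show ?thesis
    unfolding hibler_S_pairing_eq tri2_eq by (rule CS) simp
qed

text \<open>\<open>tri2\<close> vanishes on skew matrices, but for nonzero \<open>e\<close> this
  makes it definite on rank-one ones: the two squares with factor \<open>1/e^2\<close> are those of
  the real and imaginary parts of the complex product
  \<open>(\<eta>$1 + i \<eta>$2) (\<xi>$1 + i \<xi>$2)\<close>.\<close>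

lemma tri2_rank_one:
  "tri2 e (\<chi> i k. \<eta>$i * \<xi>$k) = (\<eta> \<bullet> \<xi>)^2 + 1/e^2 * ((norm \<eta>)^2 * (norm \<xi>)^2)"
proof -
  have n: "(norm v)^2 = (v$1)^2 + (v$2)^2" for v :: "real^2"
    unfolding power2_norm_eq_inner by (simp add: inner_vec_def sum_2 power2_eq_square)
  show ?thesis
    unfolding tri2_eq n by (simp add: inner_vec_def sum_2 power2_eq_square algebra_simps)
qed

text \<open>Symmetry of the bilinear form under exchange of the index pairs \<open>(i, k)\<close>
  and \<open>(j, l)\<close>; it is the source of the symmetry of the symbol.\<close>

lemma S_coeff_swap: "S_coeff e i j k l = S_coeff e j i l k"
  using exhaust_2[of i] exhaust_2[of j] exhaust_2[of k] exhaust_2[of l]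
  by (auto simp: S_coeff_def hibler_S_def)

lemma hibler_a_swap: "hibler_a \<delta> e G P i j k l = hibler_a \<delta> e G P j i l k"
  by (simp add: hibler_a_def Let_def S_coeff_swap[of e i j k l] mult_ac)

text \<open>The subtracted term of \<open>hibler_a\<close> is a product of one factor in
  \<open>(i, k)\<close> and the same factor in \<open>(j, l)\<close>, so its fourfold sum is a
  square.\<close>

lemma hibler_a_form:
  fixes \<eta> \<xi> :: "real^2" and G :: "real^2^2"
  defines "E \<equiv> sym_part G"
  shows "(\<Sum>i\<in>UNIV. \<Sum>j\<in>UNIV. \<Sum>k\<in>UNIV. \<Sum>l\<in>UNIV.
      hibler_a \<delta> e G P i j k l * \<xi>$k * \<xi>$l * \<eta>$j * \<eta>$i) =
    P / (2 * tri_delta \<delta> e E) * (tri2 e (\<chi> i k. \<eta>$i * \<xi>$k) - 1 / (tri_delta \<delta> e E)^2 *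
      (\<Sum>i\<in>UNIV. \<Sum>k\<in>UNIV. hibler_S e E $ i $ k * (\<chi> i k. \<eta>$i * \<xi>$k) $ i $ k)^2)"
proof -
  define A where "A = P / (2 * tri_delta \<delta> e E)"
  define B where "B = 1 / (tri_delta \<delta> e E)^2"
  have "hibler_a \<delta> e G P i j k l = A * (S_coeff e i j k l - B * hibler_S e E $ i $ k * hibler_S e E $ j $ l)"
    for i j k l by (simp add: hibler_a_def Let_def A_def B_def E_def)
  then have "(\<Sum>i\<in>UNIV. \<Sum>j\<in>UNIV. \<Sum>k\<in>UNIV. \<Sum>l\<in>UNIV.
      hibler_a \<delta> e G P i j k l * \<xi>$k * \<xi>$l * \<eta>$j * \<eta>$i) =
    A * ((\<Sum>i\<in>UNIV. \<Sum>j\<in>UNIV. \<Sum>k\<in>UNIV. \<Sum>l\<in>UNIV.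
        \<eta>$i * \<xi>$k * S_coeff e i j k l * (\<eta>$j * \<xi>$l)) -
      B * (\<Sum>i\<in>UNIV. \<Sum>j\<in>UNIV. \<Sum>k\<in>UNIV. \<Sum>l\<in>UNIV.
        hibler_S e E $ i $ k * (\<eta>$i * \<xi>$k) * (hibler_S e E $ j $ l * (\<eta>$j * \<xi>$l))))"
    by (simp add: sum_distrib_left sum_subtractf[symmetric] right_diff_distrib left_diff_distrib mult_ac)
  also have "(\<Sum>i\<in>UNIV. \<Sum>j\<in>UNIV. \<Sum>k\<in>UNIV. \<Sum>l\<in>UNIV.
        hibler_S e E $ i $ k * (\<eta>$i * \<xi>$k) * (hibler_S e E $ j $ l * (\<eta>$j * \<xi>$l))) =
      (\<Sum>i\<in>UNIV. \<Sum>k\<in>UNIV. hibler_S e E $ i $ k * (\<eta>$i * \<xi>$k))^2"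
    by (simp add: power2_eq_square sum_product)
  finally show ?thesis
    by (simp add: A_def B_def tri2_def)
qed

lemma hibler_a_form_ge:
  fixes \<eta> \<xi> :: "real^2" and \<delta> e P :: real and G :: "real^2^2"
  defines "\<Delta> \<equiv> tri_delta \<delta> e (sym_part G)"
  assumes "0 < \<delta>" "0 \<le> P" "norm \<xi> = 1"
  shows "P * \<delta> / (2 * \<Delta>^3 * e^2) * (norm \<eta>)^2 \<le> (\<Sum>i\<in>UNIV. \<Sum>j\<in>UNIV. \<Sum>k\<in>UNIV. \<Sum>l\<in>UNIV.
      hibler_a \<delta> e G P i j k l * \<xi>$k * \<xi>$l * \<eta>$j * \<eta>$i)"
proof -
  define E where "E = sym_part G"
  define F :: "real^2^2" where "F = (\<chi> i k. \<eta>$i * \<xi>$k)"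
  have \<Delta>2: "\<Delta>^2 = \<delta> + tri2 e E"
    using \<open>0 < \<delta>\<close> tri2_nonneg[of e E] by (simp add: \<Delta>_def tri_delta_def E_def)
  have \<Delta>pos: "0 < \<Delta>"
    using \<open>0 < \<delta>\<close> tri2_nonneg[of e "sym_part G"] by (simp add: \<Delta>_def tri_delta_def)
  have "P * \<delta> / (2 * \<Delta>^3 * e^2) * (norm \<eta>)^2
      = P / (2 * \<Delta>) * (\<delta> / \<Delta>^2 * (1 / e^2 * (norm \<eta>)^2))"
    by (simp add: power3_eq_cube power2_eq_square mult_ac)
  also have "\<dots> \<le> P / (2 * \<Delta>) * (\<delta> / \<Delta>^2 * tri2 e F)"
    using assms \<Delta>pos unfolding F_def tri2_rank_one
    by (intro mult_left_mono) auto
  \<comment> \<open>Since \<open>\<Delta>^2 = \<delta> + tri2 e E\<close>, the share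
    \<open>\<delta> / \<Delta>^2\<close> is exactly what survives the worst case of
    Cauchy-Schwarz.\<close>
  also have "\<delta> / \<Delta>^2 * tri2 e F = tri2 e F - 1 / \<Delta>^2 * (tri2 e E * tri2 e F)"
    using \<Delta>pos by (simp add: field_simps) (simp add: \<Delta>2 algebra_simps)
  also have "P / (2 * \<Delta>) * (tri2 e F - 1 / \<Delta>^2 * (tri2 e E * tri2 e F)) \<le>
      P / (2 * \<Delta>) * (tri2 e F - 1 / \<Delta>^2 *
        (\<Sum>i\<in>UNIV. \<Sum>k\<in>UNIV. hibler_S e E $ i $ k * F $ i $ k)^2)"
    using assms \<Delta>pos
    by (intro mult_left_mono diff_left_mono hibler_S_Cauchy_Schwarz) auto
  finally show ?thesis
    unfolding hibler_a_form F_def E_def \<Delta>_def .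
qed

section \<open>Real symmetric symbols: numerical range, spectrum and angle\<close>

lemma norm_complex_vec_square:
  fixes w :: "complex^2"
  shows "(norm w)^2 = (norm (\<chi> i. Re (w$i)))^2 + (norm (\<chi> i. Im (w$i)))^2"
  by (simp add: power2_norm_eq_inner inner_vec_def sum_2 inner_complex_def)

lemma cinner2_self: "cinner2 w w = of_real ((norm w)^2)"
  unfolding power2_norm_eq_inner
  by (simp add: cinner2_def inner_vec_def inner_complex_def complex_eq_iff)

text \<open>The mixed terms of real and imaginary parts cancel by symmetry, so the complex form is
  real and reduces to two real ones.\<close>

lemma cinner2_real_symmetric:
  fixes M :: "real^2^2"
  assumes "\<And>i j. M$i$j = M$j$i"
  shows "cinner2 ((\<chi> i j. of_real (M$i$j)) *v w) w =
    of_real ((\<chi> i. Re (w$i)) \<bullet> (M *v (\<chi> i. Re (w$i))) + (\<chi> i. Im (w$i)) \<bullet> (M *v (\<chi> i. Im (w$i))))"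
  using assms[of 1 2]
  by (simp add: cinner2_def matrix_vector_mult_def inner_vec_def sum_2 complex_eq_iff algebra_simps)

lemma spectrum_eigenvector:
  assumes "z \<in> spectrum M"
  obtains w where "w \<noteq> 0" "M *v w = z *s w"
proof -
  have "\<exists>w. (M - mat z) *v w = 0 \<and> w \<noteq> 0"
    using assms matrix_left_invertible_ker[of "M - mat z"]
    by (auto simp: spectrum_def invertible_left_inverse)
  then obtain w where "(M - mat z) *v w = 0" "w \<noteq> 0" by blast
  moreover have "mat z *v w = z *s w"
    by (simp add: vec_eq_iff matrix_vector_mult_def mat_def if_distrib if_distribR sum.delta' cong: if_cong)
  ultimately show thesis
    using that by (simp add: matrix_vector_mult_diff_rdistrib)
qed

text \<open>At an eigenvector \<open>w\<close> for \<open>z\<close> the form takes the value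
  \<open>z * (norm w)^2\<close>.\<close>

lemma spectrum_positive:
  assumes "\<And>w. Im (cinner2 (M *v w) w) = 0" "0 < c"
    and "\<And>w. c * (norm w)^2 \<le> Re (cinner2 (M *v w) w)"
    and z: "z \<in> spectrum M"
  shows "0 < Re z" "Im z = 0"
proof -
  obtain w where w: "w \<noteq> 0" "M *v w = z *s w"
    using spectrum_eigenvector[OF z] .
  have eq: "cinner2 (M *v w) w = z * of_real ((norm w)^2)"
    unfolding w cinner2_self[symmetric] by (simp add: cinner2_def sum_distrib_left mult.assoc)
  have "0 < (norm w)^2" using w by simp
  then show "Im z = 0"
    using assms(1)[of w] eq by simp
  have "0 < c * (norm w)^2" using \<open>0 < c\<close> \<open>0 < (norm w)^2\<close> by simp
  also have "\<dots> \<le> Re z * (norm w)^2" using assms(3)[of w] eq by simp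
  finally show "0 < Re z" using \<open>0 < (norm w)^2\<close> by (simp add: zero_less_mult_iff)
qed

text \<open>Every angle in \<open>{0<..pi}\<close> is admissible. The first conclusion ensures that
  the infimum is taken over a nonempty set.\<close>

lemma ellipticity_angle_zero:
  assumes "\<And>x \<xi> z. x \<in> K \<Longrightarrow> norm \<xi> = 1 \<Longrightarrow> z \<in> spectrum (A x \<xi>) \<Longrightarrow> 0 < Re z \<and> Im z = 0"
  shows "\<exists>\<phi>. parameter_elliptic K A \<phi>" "ellipticity_angle K A = 0"
proof -
  have "z \<in> sector \<phi>" if "0 < \<phi>" "0 < Re z \<and> Im z = 0" for z \<phi>
  proof -
    have "z = of_real (Re z)" using that by (simp add: complex_eq_iff)
    then have "Arg z = 0" using that Arg_of_real[of "Re z"] by simp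
    then show ?thesis using that by (auto simp: sector_def)
  qed
  then have *: "{\<phi>. parameter_elliptic K A \<phi>} = {0<..pi}"
    using assms by (auto simp: parameter_elliptic_def)
  then show "\<exists>\<phi>. parameter_elliptic K A \<phi>"
    using pi_gt_zero by (metis greaterThanAtMost_iff mem_Collect_eq order_refl)
  show "ellipticity_angle K A = 0"
    unfolding ellipticity_angle_def * by simp
qed

section \<open>Extension from the domain to its closure\<close>

lemma continuous_on_cl_pd:
  assumes "open \<Omega>" "f \<in> C1_closure \<Omega>"
  shows "continuous_on (closure \<Omega>) (cl_pd \<Omega> m f)"
proof -
  obtain g where g: "continuous_on (closure \<Omega>) g" "\<And>x. x \<in> \<Omega> \<Longrightarrow> g x = pd m f x"
    using assms unfolding C1_closure_def by blast
  have "cl_pd \<Omega> m f x = g x" if x: "x \<in> closure \<Omega>" for x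
  proof -
    \<comment> \<open>Needed for uniqueness of the limit: the closure of an open set has no isolated
      points.\<close>
    have "x islimpt \<Omega>"
      using x assms(1) open_imp_islimpt by (auto simp: closure_def interior_open)
    then have nt: "at x within \<Omega> \<noteq> bot" by (simp add: trivial_limit_within)
    have "(g \<longlongrightarrow> g x) (at x within \<Omega>)"
      using g(1) x closure_subset by (auto simp: continuous_on_def intro: tendsto_within_subset)
    then have "(pd m f \<longlongrightarrow> g x) (at x within \<Omega>)"
      by (rule Lim_transform_within[OF _ zero_less_one]) (simp add: g(2))
    then show ?thesis
      using nt tendsto_Lim by (auto simp: cl_pd_def)
  qed
  then show ?thesis
    using g(1) by (simp cong: continuous_on_cong)
qed

text \<open>The exceptional set inside \<open>S\<close> is open and null, hence empty; closedness of
  \<open>C\<close> then carries the property to the boundary.\<close>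

lemma AE_continuous_imp_closure:
  fixes f :: "'a::euclidean_space \<Rightarrow> 'b::topological_space"
  assumes "open S" "continuous_on (closure S) f" "closed C"
    and "AE x in lebesgue_on S. f x \<in> C" and "x \<in> closure S"
  shows "f x \<in> C"
proof -
  have "open {x \<in> S. f x \<notin> C}"
  proof -
    have "open (f -` (- C) \<inter> S)"
      using assms continuous_on_subset[OF assms(2) closure_subset] continuous_on_open_vimage by blast
    also have "f -` (- C) \<inter> S = {x \<in> S. f x \<notin> C}" by auto
    finally show ?thesis .
  qed
  moreover have "negligible {x \<in> S. f x \<notin> C}"
  proof -
    have "AE x in lebesgue. x \<in> S \<longrightarrow> f x \<in> C"
      using assms by (simp add: AE_restrict_space_iff)
    then have "AE x in lebesgue. x \<notin> {x \<in> S. f x \<notin> C}" by eventually_elim auto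
    moreover have "{x \<in> S. f x \<notin> C} \<in> sets lebesgue"
      using \<open>open {x \<in> S. f x \<notin> C}\<close> by (simp add: borel_open sets_completionI_sets)
    ultimately show ?thesis
      by (simp only: negligible_iff_null_sets AE_iff_null_sets)
  qed
  ultimately have "{x \<in> S. f x \<notin> C} = {}"
    using open_not_negligible by blast
  then have "f ` S \<subseteq> C" by auto
  then have "f ` closure S \<subseteq> C"
    using assms image_closure_subset by blast
  then show ?thesis using assms by blast
qed

theorem proposition4p1:
  fixes \<Omega> :: "pt set" and p q \<mu> \<delta> e ps c :: real and V :: "state set"
    and u0 :: "pt \<Rightarrow> real^2" and h0 a0 :: "pt \<Rightarrow> real"
  assumes "open \<Omega>" "connected \<Omega>" "\<Omega> \<noteq> {}" "bounded \<Omega>" "C2_boundary \<Omega>"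
    and "1 < p" "1 < q" "1 / p < \<mu>" "\<mu> \<le> 1" "1 / 2 + 1 / p + 1 / q < \<mu>"
    and "0 < \<delta>" "0 < e" "0 < ps" "0 < c"
    and "open_in_Xgm \<Omega> p q \<mu> V"
    and "\<exists>\<kappa>>0. \<forall>(u, h, a)\<in>V. AE x in lebesgue_on \<Omega>. h x \<ge> \<kappa> \<and> a x \<in> {0..1}"
    and "(u0, h0, a0) \<in> V"
    \<comment> \<open>by the embedding of \<open>Xgm\<close> into \<open>C\<^sup>1\<close> of the closure, every element of \<open>V\<close> has such a representative\<close>
    and "u0 \<in> C1_closure \<Omega>" "h0 \<in> C1_closure \<Omega>" "a0 \<in> C1_closure \<Omega>"
  shows "strongly_elliptic (closure \<Omega>) (principal_symbol (hibler_op \<delta> e ps c \<Omega> (u0, h0, a0))) \<and>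
    (\<exists>\<phi>. parameter_elliptic (closure \<Omega>) (principal_symbol (hibler_op \<delta> e ps c \<Omega> (u0, h0, a0))) \<phi>) \<and>
    ellipticity_angle (closure \<Omega>) (principal_symbol (hibler_op \<delta> e ps c \<Omega> (u0, h0, a0))) = 0"
proof -
  let ?A = "principal_symbol (hibler_op \<delta> e ps c \<Omega> (u0, h0, a0))"
  define G where "G = cl_jacobian \<Omega> u0"
  define P where "P x = ice_P ps c (h0 x) (a0 x)" for x
  define \<Delta> where "\<Delta> x = tri_delta \<delta> e (sym_part (G x))" for x
  define M :: "pt \<Rightarrow> real^2 \<Rightarrow> real^2^2" where
    "M x \<xi> = (\<chi> i j. \<Sum>k\<in>UNIV. \<Sum>l\<in>UNIV. hibler_a \<delta> e (G x) (P x) i j k l * \<xi>$k * \<xi>$l)" for x \<xi>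
  have A_eq: "?A x \<xi> = (\<chi> i j. of_real (M x \<xi> $ i $ j))" for x \<xi>
    by (simp add: principal_symbol_def hibler_op_def hibler_coeff_def M_def G_def P_def)
  have M_sym: "M x \<xi> $ i $ j = M x \<xi> $ j $ i" for x \<xi> i j
    unfolding M_def vec_lambda_beta
    \<comment> \<open>Exchanging the sums over \<open>k\<close> and \<open>l\<close> compensates the
      swap of the upper indices.\<close>
    by (subst sum.swap, subst hibler_a_swap) (simp add: mult_ac)

  have compact: "compact (closure \<Omega>)" using \<open>bounded \<Omega>\<close> by simp
  \<comment> \<open>The bound of \<open>hibler_a_form_ge\<close> degrades as \<open>\<Delta>\<close>
    grows, so uniformity needs an upper bound \<open>R\<close>.\<close>
  have "continuous_on (closure \<Omega>) \<Delta>"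
    unfolding \<Delta>_def G_def tri_delta_def tri2_eq sym_part_def cl_jacobian_def
    using continuous_on_cl_pd[OF \<open>open \<Omega>\<close> \<open>u0 \<in> C1_closure \<Omega>\<close>] \<open>0 < e\<close>
    by (auto intro!: continuous_intros)
  then have "bounded (\<Delta> ` closure \<Omega>)"
    using compact compact_continuous_image compact_imp_bounded by blast
  then obtain R where R: "\<And>x. x \<in> closure \<Omega> \<Longrightarrow> \<Delta> x \<le> R"
    unfolding bounded_real by (meson abs_le_D1 imageI)
  have \<Delta>_pos: "0 < \<Delta> x" for x
    using \<open>0 < \<delta>\<close> tri2_nonneg[of e "sym_part (G x)"] by (simp add: \<Delta>_def tri_delta_def)

  obtain \<kappa> where \<kappa>: "\<kappa> > 0" "AE x in lebesgue_on \<Omega>. h0 x \<ge> \<kappa> \<and> a0 x \<in> {0..1}"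
    using assms(16,17) by blast
  have h0: "h0 x \<in> {\<kappa>..}" and a0: "a0 x \<in> {0..1}" if "x \<in> closure \<Omega>" for x
  proof -
    have "continuous_on (closure \<Omega>) h0" "AE x in lebesgue_on \<Omega>. h0 x \<in> {\<kappa>..}"
      using \<open>h0 \<in> C1_closure \<Omega>\<close> \<kappa>(2) by (auto simp: C1_closure_def)
    then show "h0 x \<in> {\<kappa>..}"
      by (intro AE_continuous_imp_closure[OF \<open>open \<Omega>\<close> _ closed_atLeast _ that])
    have "continuous_on (closure \<Omega>) a0" "AE x in lebesgue_on \<Omega>. a0 x \<in> {0..1}"
      using \<open>a0 \<in> C1_closure \<Omega>\<close> \<kappa>(2) by (auto simp: C1_closure_def)
    then show "a0 x \<in> {0..1}"
      by (intro AE_continuous_imp_closure[OF \<open>open \<Omega>\<close> _ closed_atLeastAtMost _ that])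
  qed
  \<comment> \<open>The pressure at the smallest admissible values \<open>\<kappa>\<close> of
    \<open>h0\<close> and 0 of \<open>a0\<close>.\<close>
  define P0 where "P0 = ps * \<kappa> * exp (- c)"
  have P: "P0 \<le> P x" if "x \<in> closure \<Omega>" for x
    using h0[OF that] a0[OF that] \<open>0 < ps\<close> \<open>0 < c\<close> \<open>\<kappa> > 0\<close> unfolding P0_def P_def ice_P_def
    by (intro mult_mono) auto
  have "0 < P0" using \<open>0 < ps\<close> \<open>\<kappa> > 0\<close> by (simp add: P0_def)

  \<comment> \<open>The constant of \<open>hibler_a_form_ge\<close> with the least pressure
    \<open>P0\<close> and the largest \<open>\<Delta>\<close>.\<close>
  define c0 where "c0 = P0 * \<delta> / (2 * R^3 * e^2)"
  obtain x0 where "x0 \<in> closure \<Omega>" using \<open>\<Omega> \<noteq> {}\<close> closure_subset by blast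
  then have "0 < R" using R \<Delta>_pos by (meson less_le_trans)
  then have "0 < c0"
    using \<open>0 < P0\<close> \<open>0 < \<delta>\<close> \<open>0 < e\<close> by (simp add: c0_def)
  have form: "c0 * (norm \<eta>)^2 \<le> \<eta> \<bullet> (M x \<xi> *v \<eta>)"
    if "x \<in> closure \<Omega>" "norm \<xi> = 1" for x \<xi> \<eta>
  proof -
    have "c0 \<le> P x * \<delta> / (2 * (\<Delta> x)^3 * e^2)"
      unfolding c0_def using P[OF that(1)] R[OF that(1)] \<Delta>_pos[of x] \<open>0 < P0\<close> \<open>0 < \<delta>\<close> \<open>0 < e\<close>
      by (intro frac_le mult_right_mono mult_left_mono power_mono) auto
    then have "c0 * (norm \<eta>)^2 \<le> P x * \<delta> / (2 * (\<Delta> x)^3 * e^2) * (norm \<eta>)^2"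
      by (rule mult_right_mono) simp
    also have "\<dots> \<le> (\<Sum>i\<in>UNIV. \<Sum>j\<in>UNIV. \<Sum>k\<in>UNIV. \<Sum>l\<in>UNIV.
        hibler_a \<delta> e (G x) (P x) i j k l * \<xi>$k * \<xi>$l * \<eta>$j * \<eta>$i)"
      unfolding \<Delta>_def using P[OF that(1)] \<open>0 < P0\<close> \<open>0 < \<delta>\<close> that(2) by (intro hibler_a_form_ge) auto
    also have "\<dots> = \<eta> \<bullet> (M x \<xi> *v \<eta>)"
      by (simp add: M_def matrix_vector_mult_def inner_vec_def sum_distrib_left sum_distrib_right mult_ac)
    finally show ?thesis .
  qed

  have Re_ge: "c0 * (norm w)^2 \<le> Re (cinner2 (?A x \<xi> *v w) w)"
    if "x \<in> closure \<Omega>" "norm \<xi> = 1" for x \<xi> w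
    using form[OF that, of "\<chi> i. Re (w$i)"] form[OF that, of "\<chi> i. Im (w$i)"]
    by (simp add: A_eq cinner2_real_symmetric[OF M_sym] norm_complex_vec_square[of w] distrib_left)
  then have "strongly_elliptic (closure \<Omega>) ?A"
    using \<open>0 < c0\<close> by (auto simp: strongly_elliptic_def)
  moreover have "0 < Re z \<and> Im z = 0"
    if "x \<in> closure \<Omega>" "norm \<xi> = 1" "z \<in> spectrum (?A x \<xi>)" for x \<xi> z
  proof -
    have "Im (cinner2 (?A x \<xi> *v w) w) = 0" for w
      by (simp only: A_eq cinner2_real_symmetric[OF M_sym] Im_complex_of_real)
    then show ?thesis
      using spectrum_positive[OF _ \<open>0 < c0\<close> Re_ge[OF that(1,2)] that(3)] by blast
  qed
  ultimately show ?thesis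
    using ellipticity_angle_zero[of "closure \<Omega>" ?A] by blast
qed

end
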